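(* It is not true in general that if $\widehat a$ is a solution of Problem (Pc) with length $t_f=\widehat t_f$ fixed, then $\widehat t_f$ is a solution of Problem (MD) with curvature bound $a=\widehat a$ fixed. Specifically, take $(x_0,y_0,\theta_0)=(0,0,0)$, $(x_f,y_f,\theta_f)=(1,0,0)$ and $\widehat t_f=2$, and let $\widehat a$ be the minimal value of Problem (Pc) with $t_f=\widehat t_f$. Then $\widehat a>0$, and Problem (MD) with $a=\widehat a$ fixed has minimal length $t_f^*=1<\widehat t_f$ (attained by $\theta^*(t)=0$ for all $t\in[0,t_f^*]$).
   Context: Fix endpoint data $(x_0,y_0,\theta_0),(x_f,y_f,\theta_f)\in\mathbb R^3$. Consider the constraints on $(x,y,\theta,u)$ on $[0,t_f]$, with $x,y,\theta$ absolutely continuous and $u\in L^\infty(0,t_f;\mathbb R)$: $$\dot x=\cos\theta,\quad \dot y=\sin\theta,\quad \dot\theta=u,\quad |u(t)|\le a\ \text{ for a.e. } t\in[0,t_f],$$ $$(x,y,\theta)(0)=(x_0,y_0,\theta_0),\qquad (x,y,\theta)(t_f)=(x_f,y_f,\theta_f),$$ where angles at the endpoints are understood modulo $2\pi$. Problem (Pc): with $t_f$ fixed, minimize $a\ge 0$ over $a$ and $u$ subject to these constraints. Problem (MD) (Markov--Dubins): with $a$ fixed, minimize $t_f$ over $t_f$ and $u$ subject to these constraints. *)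

theory Defs
  imports "HOL-Analysis.Analysis" "HOL-Library.Real_Mod"
begin

definition absolutely_continuous_on_interval :: "real \<Rightarrow> real \<Rightarrow> (real \<Rightarrow> real) \<Rightarrow> bool" where
  "absolutely_continuous_on_interval s t f \<longleftrightarrow>
     (\<forall>\<epsilon>>0. \<exists>\<delta>>0. \<forall>n (l :: nat \<Rightarrow> real) r.
        (\<forall>i<n. s \<le> l i \<and> l i \<le> r i \<and> r i \<le> t) \<longrightarrow>
        disjoint_family_on (\<lambda>i. {l i<..<r i}) {..<n} \<longrightarrow>
        (\<Sum>i<n. r i - l i) < \<delta> \<longrightarrow>
        (\<Sum>i<n. \<bar>f (r i) - f (l i)\<bar>) < \<epsilon>)"

definition L_infinity_on :: "real set \<Rightarrow> (real \<Rightarrow> real) \<Rightarrow> bool" where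
  "L_infinity_on S u \<longleftrightarrow>
     u \<in> borel_measurable (lebesgue_on S) \<and>
     (\<exists>M. AE t in lebesgue_on S. \<bar>u t\<bar> \<le> M)"

text \<open>Endpoint data are triples \<open>(x, y, \<theta>)\<close>. States and controls are total functions on the reals
  of which only the restriction to \<open>{0..tf}\<close> matters.\<close>

type_synonym endpoint = "real \<times> real \<times> real"

definition at_endpoint :: "endpoint \<Rightarrow> real \<Rightarrow> real \<Rightarrow> real \<Rightarrow> bool" where
  "at_endpoint p x y \<theta> \<longleftrightarrow>
     (case p of (xp, yp, \<theta>p) \<Rightarrow> x = xp \<and> y = yp \<and> [\<theta> = \<theta>p] (rmod (2 * pi)))"

definition admissible ::
  "endpoint \<Rightarrow> endpoint \<Rightarrow> real \<Rightarrow> real \<Rightarrow>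
   (real \<Rightarrow> real) \<Rightarrow> (real \<Rightarrow> real) \<Rightarrow> (real \<Rightarrow> real) \<Rightarrow> (real \<Rightarrow> real) \<Rightarrow> bool" where
  "admissible p0 pf tf a x y \<theta> u \<longleftrightarrow>
     absolutely_continuous_on_interval 0 tf x \<and>
     absolutely_continuous_on_interval 0 tf y \<and>
     absolutely_continuous_on_interval 0 tf \<theta> \<and>
     L_infinity_on {0..tf} u \<and>
     (AE t in lebesgue_on {0..tf}. (x has_real_derivative cos (\<theta> t)) (at t within {0..tf})) \<and>
     (AE t in lebesgue_on {0..tf}. (y has_real_derivative sin (\<theta> t)) (at t within {0..tf})) \<and>
     (AE t in lebesgue_on {0..tf}. (\<theta> has_real_derivative u t) (at t within {0..tf})) \<and>
     (AE t in lebesgue_on {0..tf}. \<bar>u t\<bar> \<le> a) \<and>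
     at_endpoint p0 (x 0) (y 0) (\<theta> 0) \<and>
     at_endpoint pf (x tf) (y tf) (\<theta> tf)"

definition feasible :: "endpoint \<Rightarrow> endpoint \<Rightarrow> real \<Rightarrow> real \<Rightarrow> (real \<Rightarrow> real) \<Rightarrow> bool" where
  "feasible p0 pf tf a u \<longleftrightarrow> 0 \<le> tf \<and> (\<exists>x y \<theta>. admissible p0 pf tf a x y \<theta> u)"

definition Pc_optimal :: "endpoint \<Rightarrow> endpoint \<Rightarrow> real \<Rightarrow> real \<Rightarrow> (real \<Rightarrow> real) \<Rightarrow> bool" where
  "Pc_optimal p0 pf tf a u \<longleftrightarrow>
     is_arg_min fst (\<lambda>(a, u). 0 \<le> a \<and> feasible p0 pf tf a u) (a, u)"

definition Pc_solution :: "endpoint \<Rightarrow> endpoint \<Rightarrow> real \<Rightarrow> real \<Rightarrow> bool" where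
  "Pc_solution p0 pf tf a \<longleftrightarrow> (\<exists>u. Pc_optimal p0 pf tf a u)"

definition MD_optimal :: "endpoint \<Rightarrow> endpoint \<Rightarrow> real \<Rightarrow> real \<Rightarrow> (real \<Rightarrow> real) \<Rightarrow> bool" where
  "MD_optimal p0 pf a tf u \<longleftrightarrow> is_arg_min fst (\<lambda>(tf, u). feasible p0 pf tf a u) (tf, u)"

definition MD_solution :: "endpoint \<Rightarrow> endpoint \<Rightarrow> real \<Rightarrow> real \<Rightarrow> bool" where
  "MD_solution p0 pf a tf \<longleftrightarrow> (\<exists>u. MD_optimal p0 pf a tf u)"

end

theory Submission
  imports Defs "HOL-Complex_Analysis.Great_Picard"
begin

text \<open>
  For the endpoints \<open>(0, 0, 0)\<close> and \<open>(1, 0, 0)\<close> the straight segment has length \<open>1\<close> and zero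
  curvature, so it is feasible under every curvature bound; since the speed is \<open>1\<close>, nothing shorter
  reaches the target. Hence the Markov--Dubins optimum is \<open>1\<close> for every bound. With the length
  fixed to \<open>2\<close> a curve of zero curvature that starts with angle \<open>0\<close> ends at \<open>(2, 0, 0)\<close>:
  the minimal curvature bound is positive, and Markov--Dubins with that bound does not return
  the length \<open>2\<close>.

  The substance is that the minimal bound for length \<open>2\<close> is attained.
  The proof is the direct method, for arbitrary endpoints and length. A feasible control for
  the bound \<open>a\<close> exists exactly when there is an \<open>a\<close>-Lipschitz angle function with the right
  endpoint angles and the right integrals of its cosine and sine (the predicate \<open>heading\<close>;
  \<open>admissible_imp_heading\<close>, \<open>heading_imp_feasible\<close>). Lipschitz angle functions are compact by
  Arzela--Ascoli and every clause of \<open>heading\<close> passes to limits, so the infimum of the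
  feasible bounds is feasible (\<open>Pc_solution_exists\<close>); that some bound is feasible for length \<open>2\<close> is
  seen from a segment followed by a full circle of circumference \<open>1\<close> (\<open>heading_loop\<close>).

  The equivalence rests on two facts of real analysis. From a control to Lipschitz
  continuity: the fundamental theorem of calculus for absolutely continuous functions
  (\<open>absolutely_continuous_on_interval_has_integral\<close>). From Lipschitz continuity back to a control:
  Rademacher's theorem on the line (\<open>lipschitz_on_UNIV_has_ae_derivative\<close>).
\<close>

section \<open>Absolutely continuous functions and the gauge integral\<close>

text \<open>
  Tagged divisions are sets of tagged intervals, so absolute continuity is wanted for families with
  an arbitrary finite index set instead of an initial segment of the naturals.
\<close>

lemma absolutely_continuous_on_interval_finite:
  fixes f :: "real \<Rightarrow> real"
  assumes f: "absolutely_continuous_on_interval s t f" and "\<epsilon> > 0"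
  shows "\<exists>\<delta>>0. \<forall>B (l :: 'i \<Rightarrow> real) r.
    finite B \<longrightarrow> (\<forall>i\<in>B. s \<le> l i \<and> l i \<le> r i \<and> r i \<le> t) \<longrightarrow>
    disjoint_family_on (\<lambda>i. {l i<..<r i}) B \<longrightarrow> (\<Sum>i\<in>B. r i - l i) < \<delta> \<longrightarrow>
    (\<Sum>i\<in>B. \<bar>f (r i) - f (l i)\<bar>) < \<epsilon>"
proof -
  obtain \<delta> where "\<delta> > 0" and \<delta>: "\<forall>n (l :: nat \<Rightarrow> real) r.
        (\<forall>i<n. s \<le> l i \<and> l i \<le> r i \<and> r i \<le> t) \<longrightarrow>
        disjoint_family_on (\<lambda>i. {l i<..<r i}) {..<n} \<longrightarrow>
        (\<Sum>i<n. r i - l i) < \<delta> \<longrightarrow> (\<Sum>i<n. \<bar>f (r i) - f (l i)\<bar>) < \<epsilon>"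
    using f[unfolded absolutely_continuous_on_interval_def, rule_format, OF \<open>\<epsilon> > 0\<close>]
    by (elim exE conjE)
  show ?thesis
  proof (intro exI[of _ \<delta>] conjI allI impI \<open>\<delta> > 0\<close>)
    fix B :: "'i set" and l r :: "'i \<Rightarrow> real"
    assume B: "finite B" and lr: "\<forall>i\<in>B. s \<le> l i \<and> l i \<le> r i \<and> r i \<le> t"
      and dis: "disjoint_family_on (\<lambda>i. {l i<..<r i}) B" and sm: "(\<Sum>i\<in>B. r i - l i) < \<delta>"
    obtain h where h: "bij_betw h {..<card B} B"
      using ex_bij_betw_nat_finite[OF B] by (auto simp: lessThan_atLeast0)
    have "(\<Sum>i<card B. \<bar>f (r (h i)) - f (l (h i))\<bar>) < \<epsilon>"
    proof (rule \<delta>[rule_format])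
      show "s \<le> l (h i) \<and> l (h i) \<le> r (h i) \<and> r (h i) \<le> t" if "i < card B" for i
        using that lr h by (auto simp: bij_betw_def)
      show "disjoint_family_on (\<lambda>i. {l (h i)<..<r (h i)}) {..<card B}"
      proof (unfold disjoint_family_on_def, intro ballI impI)
        fix i j assume "i \<in> {..<card B}" "j \<in> {..<card B}" "i \<noteq> j"
        then have "h i \<in> B" "h j \<in> B" "h i \<noteq> h j"
          using h by (auto simp: bij_betw_def inj_on_def)
        then show "{l (h i)<..<r (h i)} \<inter> {l (h j)<..<r (h j)} = {}"
          by (rule disjoint_family_onD[OF dis])
      qed
      show "(\<Sum>i<card B. r (h i) - l (h i)) < \<delta>"
        using sm sum.reindex_bij_betw[OF h, of "\<lambda>i. r i - l i"] by simp
    qed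
    then show "(\<Sum>i\<in>B. \<bar>f (r i) - f (l i)\<bar>) < \<epsilon>"
      using sum.reindex_bij_betw[OF h, of "\<lambda>i. \<bar>f (r i) - f (l i)\<bar>"] by simp
  qed
qed

text \<open>
  The integral is the gauge integral. At a point where \<open>f\<close> is differentiable the gauge is small
  enough for the straddle estimate. On the exceptional null set it is an open set of measure
  less than the \<open>\<delta>\<close> of absolute continuity, so the tagged intervals there, on which the integrand
  is taken to be \<open>0\<close>, contribute little to the telescoping sum for \<open>f q - f p\<close>.
\<close>

theorem absolutely_continuous_on_interval_has_integral:
  fixes f g :: "real \<Rightarrow> real"
  assumes "p \<le> q" and f: "absolutely_continuous_on_interval p q f" and N: "negligible N"
    and der: "\<And>x. x \<in> {p..q} - N \<Longrightarrow> (f has_real_derivative g x) (at x within {p..q})"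
  shows "(g has_integral f q - f p) {p..q}"
proof -
  define g0 where "g0 = (\<lambda>x. if x \<in> N then 0 else g x)"
  have g0: "(g0 has_integral f q - f p) {p..q}"
    unfolding has_integral_real
  proof (intro allI impI)
    fix e :: real assume "e > 0"
    \<comment> \<open>The summand \<open>1\<close> keeps the denominator positive when \<open>p = q\<close>.\<close>
    define e1 where "e1 = e / (2 * (q - p + 1))"
    have "e1 > 0" using \<open>e > 0\<close> \<open>p \<le> q\<close> by (simp add: e1_def)
    have e1: "e1 * (q - p) \<le> e / 2"
      using \<open>e > 0\<close> \<open>p \<le> q\<close> by (simp add: e1_def divide_simps)
    have "\<forall>x. \<exists>d>0. x \<in> {p..q} - N \<longrightarrow>
         (\<forall>y\<in>{p..q}. norm (y-x) < d \<longrightarrow> norm (f y - f x - g x * (y-x)) \<le> e1 * norm (y-x))"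
      using der[unfolded has_field_derivative_def has_derivative_within_alt] \<open>e1 > 0\<close>
      by metis
    then obtain d where d: "\<And>x. 0 < d x"
         "\<And>x y. \<lbrakk>x \<in> {p..q} - N; y \<in> {p..q}; norm (y-x) < d x\<rbrakk>
                        \<Longrightarrow> norm (f y - f x - g x * (y-x)) \<le> e1 * norm (y-x)"
      by metis
    from \<open>e > 0\<close> have "e / 2 > 0" by simp
    obtain \<delta> where "\<delta> > 0" and
      \<delta>: "\<forall>B (l :: real \<times> real set \<Rightarrow> real) r.
        finite B \<longrightarrow> (\<forall>i\<in>B. p \<le> l i \<and> l i \<le> r i \<and> r i \<le> q) \<longrightarrow>
        disjoint_family_on (\<lambda>i. {l i<..<r i}) B \<longrightarrow> (\<Sum>i\<in>B. r i - l i) < \<delta> \<longrightarrow>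
        (\<Sum>i\<in>B. \<bar>f (r i) - f (l i)\<bar>) < e / 2"
      using absolutely_continuous_on_interval_finite[OF f \<open>e / 2 > 0\<close>] by (elim exE conjE)
    have "N \<in> sets lebesgue" "N \<in> lmeasurable" using N negligible_imp_sets negligible_imp_measurable by auto
    then obtain U where U: "open U" "N \<subseteq> U" "U - N \<in> lmeasurable" "emeasure lebesgue (U - N) < ennreal \<delta>"
      using sets_lebesgue_outer_open[of N \<delta>] \<open>\<delta> > 0\<close> by metis
    have "U = (U - N) \<union> N" using U by auto
    then have Um: "U \<in> lmeasurable"
      using U(3) \<open>N \<in> lmeasurable\<close> by (metis fmeasurable.Un)
    have "measure lebesgue U \<le> measure lebesgue (U - N) + measure lebesgue N"
      using \<open>U = (U - N) \<union> N\<close> measure_Un_le[of "U - N" lebesgue N] U(3) \<open>N \<in> sets lebesgue\<close>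
      by (metis fmeasurableD)
    moreover have "measure lebesgue (U - N) < \<delta>"
      using U(3,4) \<open>\<delta> > 0\<close> by (metis emeasure_eq_measure2 ennreal_less_iff measure_nonneg)
    ultimately have U: "open U" "N \<subseteq> U" "U \<in> lmeasurable" "measure lebesgue U < \<delta>"
      using Um U negligible_imp_measure0[OF N] by auto
    define \<gamma> where "\<gamma> = (\<lambda>x. if x \<in> N then U else ball x (d x))"
    have gau: "gauge \<gamma>"
      using U d(1) by (auto simp: gauge_def \<gamma>_def)
    have sm: "norm ((\<Sum>(x,K)\<in>\<D>. measure lborel K *\<^sub>R g0 x) - (f q - f p)) < e"
      if tag: "\<D> tagged_division_of {p..q}" and fine: "\<gamma> fine \<D>" for \<D>
    proof -
      have fin: "finite \<D>" using tag by auto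
      have K: "\<exists>u v. K = {u..v} \<and> p \<le> u \<and> u \<le> x \<and> x \<le> v \<and> v \<le> q \<and> K \<subseteq> \<gamma> x"
        if "(x, K) \<in> \<D>" for x K
      proof -
        have 1: "x \<in> K" "K \<subseteq> {p..q}" "\<exists>a b. K = cbox a b" "K \<subseteq> \<gamma> x"
          using tagged_division_ofD(2-4)[OF tag that] that fine by (auto simp: fine_def)
        then obtain u v where "K = {u..v}" by auto
        with 1 show ?thesis by auto
      qed
      \<comment> \<open>The members tagged in the exceptional set; all others are covered by the straddle estimate.\<close>
      define B where "B = {(x,K)\<in>\<D>. x \<in> N}"
      have "B \<subseteq> \<D>" by (auto simp: B_def)
      then have finB: "finite B" using fin finite_subset by blast
      have bad: "(\<Sum>i\<in>B. \<bar>f (Sup (snd i)) - f (Inf (snd i))\<bar>) < e / 2"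
      proof (rule \<delta>[rule_format, OF finB])
        have Ki: "\<exists>u v. snd i = {u..v} \<and> p \<le> u \<and> u \<le> v \<and> v \<le> q \<and> snd i \<subseteq> U" if "i \<in> B" for i
        proof -
          have "(fst i, snd i) \<in> \<D>" "fst i \<in> N" using that by (auto simp: B_def)
          then show ?thesis using K[of "fst i" "snd i"] by (auto simp: \<gamma>_def)
        qed
        show "p \<le> Inf (snd i) \<and> Inf (snd i) \<le> Sup (snd i) \<and> Sup (snd i) \<le> q" if "i \<in> B" for i
          using Ki[OF that] by auto
        have Ioo: "{Inf (snd i)<..<Sup (snd i)} = interior (snd i)" if "i \<in> B" for i
          using Ki[OF that] by (auto simp: interior_atLeastAtMost_real)
        have dis: "disjoint_family_on (\<lambda>i. interior (snd i)) B"
        proof (unfold disjoint_family_on_def, intro ballI impI)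
          fix i j assume "i \<in> B" "j \<in> B" "i \<noteq> j"
          then have "(fst i, snd i) \<in> \<D>" "(fst j, snd j) \<in> \<D>" "(fst i, snd i) \<noteq> (fst j, snd j)"
            using \<open>B \<subseteq> \<D>\<close> by auto
          then show "interior (snd i) \<inter> interior (snd j) = {}"
            by (rule tagged_division_ofD(5)[OF tag])
        qed
        then show "disjoint_family_on (\<lambda>i. {Inf (snd i)<..<Sup (snd i)}) B"
          using Ioo by (auto simp: disjoint_family_on_def)
        have "(\<Sum>i\<in>B. Sup (snd i) - Inf (snd i)) = (\<Sum>i\<in>B. measure lebesgue (interior (snd i)))"
        proof (rule sum.cong)
          fix i assume "i \<in> B"
          then show "Sup (snd i) - Inf (snd i) = measure lebesgue (interior (snd i))"
            using Ki[of i] by (auto simp: interior_atLeastAtMost_real)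
        qed simp
        also have "\<dots> = measure lebesgue (\<Union>i\<in>B. interior (snd i))"
        proof (rule measure_finite_Union[symmetric, OF finB _ dis])
          show "emeasure lebesgue (interior (snd i)) \<noteq> \<infinity>" if "i \<in> B" for i
            using Ki[OF that] by (auto simp: interior_atLeastAtMost_real)
        qed auto
        also have "\<dots> \<le> measure lebesgue U"
        proof (rule measure_mono_fmeasurable)
          show "(\<Union>i\<in>B. interior (snd i)) \<subseteq> U"
          proof (rule UN_least)
            fix i assume "i \<in> B"
            then have "snd i \<subseteq> U" using Ki[OF \<open>i \<in> B\<close>] by blast
            then show "interior (snd i) \<subseteq> U" using interior_subset by (rule order_trans[rotated])
          qed
          have "open (\<Union>i\<in>B. interior (snd i))" by auto
          then show "(\<Union>i\<in>B. interior (snd i)) \<in> sets lebesgue"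
            by (intro sets_completionI_sets) (simp add: borel_open)
        qed (use U in auto)
        finally show "(\<Sum>i\<in>B. Sup (snd i) - Inf (snd i)) < \<delta>"
          using U(4) by linarith
      qed
      have good: "\<bar>measure lborel K * g0 x - (f (Sup K) - f (Inf K))\<bar> \<le> e1 * (Sup K - Inf K)"
        if "(x, K) \<in> \<D> - B" for x K
      proof -
        have xK: "(x, K) \<in> \<D>" and xN: "x \<notin> N" using that by (auto simp: B_def)
        obtain u v where uv: "K = {u..v}" "p \<le> u" "u \<le> x" "x \<le> v" "v \<le> q" "K \<subseteq> \<gamma> x"
          using K[OF xK] by blast
        then have "u \<in> K" "v \<in> K" by auto
        then have "u \<in> \<gamma> x" "v \<in> \<gamma> x" using uv(6) by blast+
        then have *: "norm (u - x) < d x" "norm (v - x) < d x"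
          using xN by (auto simp: \<gamma>_def dist_norm norm_minus_commute)
        have "\<bar>f u - f x - g x * (u-x)\<bar> \<le> e1 * (x - u)"
          using d(2)[of x u] *(1) uv(2-5) xN by (simp add: abs_minus_commute)
        moreover have "\<bar>f v - f x - g x * (v-x)\<bar> \<le> e1 * (v - x)"
          using d(2)[of x v] *(2) uv(2-5) xN by (simp add: abs_minus_commute)
        ultimately have "\<bar>(v - u) * g x - (f v - f u)\<bar> \<le> e1 * (v - u)"
          by (simp add: algebra_simps abs_le_iff)
        then show ?thesis using uv(1-5) xN by (simp add: g0_def)
      qed
      have eq: "f q - f p = (\<Sum>(x,K)\<in>\<D>. f (Sup K) - f (Inf K))"
        "q - p = (\<Sum>(x,K)\<in>\<D>. Sup K - Inf K)"
        using additive_tagged_division_1[OF \<open>p \<le> q\<close> tag, of f]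
          additive_tagged_division_1[OF \<open>p \<le> q\<close> tag, of "\<lambda>x. x"] by auto
      define h where "h = (\<lambda>(x,K). measure lborel K * g0 x - (f (Sup K) - f (Inf K)))"
      have "(\<Sum>(x,K)\<in>\<D>. measure lborel K *\<^sub>R g0 x) - (f q - f p) = (\<Sum>i\<in>\<D>. h i)"
        unfolding eq sum_subtractf[symmetric] by (simp add: case_prod_unfold h_def)
      then have "\<bar>(\<Sum>(x,K)\<in>\<D>. measure lborel K *\<^sub>R g0 x) - (f q - f p)\<bar> \<le> (\<Sum>i\<in>\<D>. \<bar>h i\<bar>)"
        by (simp only: sum_abs)
      moreover have "(\<Sum>i\<in>\<D>. \<bar>h i\<bar>) = (\<Sum>i\<in>\<D> - B. \<bar>h i\<bar>) + (\<Sum>i\<in>B. \<bar>h i\<bar>)"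
        by (rule sum.subset_diff[OF \<open>B \<subseteq> \<D>\<close> fin])
      moreover have "(\<Sum>i\<in>B. \<bar>h i\<bar>) = (\<Sum>i\<in>B. \<bar>f (Sup (snd i)) - f (Inf (snd i))\<bar>)"
        by (rule sum.cong) (auto simp: B_def g0_def h_def)
      moreover have "(\<Sum>i\<in>\<D> - B. \<bar>h i\<bar>) \<le> (\<Sum>i\<in>\<D> - B. e1 * (Sup (snd i) - Inf (snd i)))"
        by (rule sum_mono) (simp add: case_prod_unfold good h_def)
      moreover have "(\<Sum>i\<in>\<D> - B. e1 * (Sup (snd i) - Inf (snd i)))
          \<le> (\<Sum>i\<in>\<D>. e1 * (Sup (snd i) - Inf (snd i)))"
      proof (rule sum_mono2[OF fin])
        fix i assume "i \<in> \<D> - (\<D> - B)"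
        then have "\<exists>u v. snd i = {u..v} \<and> u \<le> v"
          using K[of "fst i" "snd i"] by force
        then show "0 \<le> e1 * (Sup (snd i) - Inf (snd i))"
          using \<open>e1 > 0\<close> by auto
      qed simp
      moreover have "(\<Sum>i\<in>\<D>. e1 * (Sup (snd i) - Inf (snd i))) = e1 * (q - p)"
        by (simp add: eq(2) sum_distrib_left case_prod_unfold)
      ultimately show ?thesis using bad e1 unfolding real_norm_def by linarith
    qed
    show "\<exists>\<gamma>. gauge \<gamma> \<and> (\<forall>\<D>. \<D> tagged_division_of {p..q} \<and> \<gamma> fine \<D> \<longrightarrow>
        norm ((\<Sum>(x,K)\<in>\<D>. measure lborel K *\<^sub>R g0 x) - (f q - f p)) < e)"
      by (intro exI[of _ \<gamma>] conjI allI impI gau, elim conjE) (rule sm)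
  qed
  show ?thesis
    by (rule has_integral_spike[OF N _ g0]) (simp add: g0_def)
qed

section \<open>Lipschitz functions and almost everywhere differentiability\<close>

text \<open>
  Adding a linear function makes \<open>F\<close> a bi-Lipschitz increasing bijection \<open>G\<close>. The
  push-forward of Lebesgue measure along the inverse of \<open>G\<close> gives \<open>{s..t}\<close> the mass \<open>G t - G s\<close>.
  It is absolutely continuous, because Lipschitz images of null sets are null, so \<open>G\<close> is the
  indefinite integral of its Radon--Nikodym density, and the density is the derivative of its
  indefinite integral almost everywhere.
\<close>

theorem lipschitz_on_UNIV_has_ae_derivative:
  fixes F :: "real \<Rightarrow> real"
  assumes F: "L-lipschitz_on UNIV F"
  obtains u N where "u \<in> borel_measurable borel" "negligible N"
    "\<And>t. t \<notin> N \<Longrightarrow> (F has_real_derivative u t) (at t)"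
proof -
  have "L \<ge> 0" using F lipschitz_on_nonneg by blast
  have Fd: "\<bar>F t - F s\<bar> \<le> L * \<bar>t - s\<bar>" for s t
    using lipschitz_onD[OF F, of t s] by (simp add: dist_real_def)
  define G where "G = (\<lambda>t. F t + (L + 1) * t)"
  have low: "t - s \<le> G t - G s" and upp: "G t - G s \<le> (2 * L + 1) * (t - s)" if "s \<le> t" for s t
    using Fd[of t s] that by (auto simp: G_def algebra_simps abs_le_iff)
  have Glip: "\<bar>G t - G s\<bar> \<le> (2 * L + 1) * \<bar>t - s\<bar>" for s t
  proof (cases "s \<le> t")
    case True then show ?thesis using low[of s t] upp[of s t] by simp
  next
    case False then show ?thesis using low[of t s] upp[of t s] by (simp add: abs_minus_commute)
  qed
  have Gmono: "strict_mono G"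
  proof (rule strict_monoI)
    fix x y :: real assume "x < y" then show "G x < G y" using low[of x y] by simp
  qed
  have Gcont: "continuous_on UNIV G"
  proof -
    have "(2 * L + 1)-lipschitz_on UNIV G"
      using Glip \<open>L \<ge> 0\<close> by (intro lipschitz_onI) (auto simp: dist_real_def)
    then show ?thesis by (rule lipschitz_on_continuous_on)
  qed
  have "\<exists>x. G x = y" for y
  proof -
    define b where "b = \<bar>y\<bar> + \<bar>G 0\<bar>"
    have "b \<ge> 0" by (simp add: b_def)
    have "G (-b) \<le> y" "y \<le> G b"
      using low[of 0 b] low[of "-b" 0] \<open>b \<ge> 0\<close> unfolding b_def by linarith+
    moreover have "continuous_on {-b..b} G"
      using Gcont continuous_on_subset by blast
    ultimately show ?thesis
      using IVT'[of G "-b" y b] \<open>b \<ge> 0\<close> by auto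
  qed
  then have surjG: "surj G" by (metis surjI)
  have injG: "inj G" using Gmono strict_mono_imp_inj_on by blast
  define K where "K = inv G"
  have KG: "K (G t) = t" and GK: "G (K t) = t" for t
    unfolding K_def using injG surjG by (auto simp: surj_f_inv_f)
  have le_iff: "G s \<le> G t \<longleftrightarrow> s \<le> t" for s t
    using Gmono by (simp add: strict_mono_less_eq)
  have "mono K"
    by (rule monoI) (metis GK le_iff)
  then have K [measurable]: "K \<in> borel_measurable borel"
    by (rule borel_measurable_mono)
  define \<mu> where "\<mu> = distr lborel borel K"
  have Kvim: "K -` A = G ` A" for A
    using KG GK by (auto simp: image_iff) metis
  have \<mu>: "emeasure \<mu> A = emeasure lborel (G ` A)" if "A \<in> sets borel" for A
    using that K by (simp add: \<mu>_def emeasure_distr Kvim)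
  have "absolutely_continuous lborel \<mu>"
    unfolding absolutely_continuous_def
  proof
    fix A assume A: "A \<in> null_sets (lborel :: real measure)"
    then have Ab: "A \<in> sets borel" by auto
    have "negligible A"
      using A by (simp add: negligible_iff_null_sets null_sets_completionI)
    then have "negligible (G ` A)"
    proof (rule negligible_locally_Lipschitz_image[rotated])
      fix x show "\<exists>T B. open T \<and> x \<in> T \<and> (\<forall>y\<in>A \<inter> T. norm (G y - G x) \<le> B * norm (y - x))"
        using Glip by (intro exI[of _ UNIV] exI[of _ "2 * L + 1"]) auto
    qed simp
    then have "emeasure lebesgue (G ` A) = 0"
      by (simp add: negligible_iff_null_sets null_setsD1)
    moreover have "G ` A \<in> sets borel"
      using measurable_sets[OF K Ab] by (simp add: Kvim)
    ultimately have "emeasure \<mu> A = 0"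
      using \<mu>[OF Ab] by simp
    then show "A \<in> null_sets \<mu>"
      using Ab by (auto simp: null_sets_def \<mu>_def)
  qed
  moreover have "sets \<mu> = sets lborel" by (simp add: \<mu>_def)
  ultimately obtain f where f [measurable]: "f \<in> borel_measurable lborel" and dens: "density lborel f = \<mu>"
    using sigma_finite_measure.Radon_Nikodym[OF sigma_finite_lborel] by blast
  define g where "g = (\<lambda>x. enn2real (f x))"
  have g [measurable]: "g \<in> borel_measurable borel"
    unfolding g_def using f by measurable
  have Gint: "(g has_integral G t - G s) {s..t}" if "s \<le> t" for s t
  proof -
    have "s \<le> K y \<longleftrightarrow> G s \<le> y" "K y \<le> t \<longleftrightarrow> y \<le> G t" for y
      using le_iff[of s "K y"] le_iff[of "K y" t] GK by simp_all
    then have img: "G ` {s..t} = {G s..G t}"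
      unfolding Kvim[symmetric] by auto
    have "G s \<le> G t" using le_iff that by simp
    have "(\<integral>\<^sup>+x. f x * indicator {s..t} x \<partial>lborel) = emeasure \<mu> {s..t}"
      unfolding dens[symmetric] by (subst emeasure_density) auto
    also have "\<dots> = ennreal (G t - G s)"
      using \<open>G s \<le> G t\<close> by (simp add: \<mu> img)
    finally have I: "(\<integral>\<^sup>+x. f x * indicator {s..t} x \<partial>lborel) = ennreal (G t - G s)" .
    have "AE x in lborel. f x * indicator {s..t} x \<noteq> \<infinity>"
      by (rule nn_integral_PInf_AE) (auto simp: I)
    then have "(\<integral>\<^sup>+x. ennreal (g x * indicator {s..t} x) \<partial>lborel) = ennreal (G t - G s)"
      unfolding I[symmetric]
      by (intro nn_integral_cong_AE) (auto elim!: eventually_mono simp: g_def indicator_def less_top)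
    then have "((\<lambda>x. g x * indicator {s..t} x) has_integral G t - G s) UNIV"
      using \<open>G s \<le> G t\<close> by (intro nn_integral_has_integral) (auto simp: g_def)
    moreover have "(\<lambda>x. g x * indicator {s..t} x) = (\<lambda>x. if x \<in> {s..t} then g x else 0)"
      by (auto simp: indicator_def)
    ultimately show ?thesis
      by (simp only: has_integral_restrict_UNIV)
  qed
  have "g integrable_on cbox a b" for a b
    using Gint[of a b] by (cases "a \<le> b") (auto simp: integrable_on_def)
  then obtain N1 where N1: "negligible N1"
    and der1: "\<And>x e. \<lbrakk>x \<notin> N1; 0 < e\<rbrakk> \<Longrightarrow> \<exists>d>0. \<forall>h. 0 < h \<and> h < d \<longrightarrow>
      norm (integral (cbox x (x + h *\<^sub>R One)) g /\<^sub>R h ^ DIM(real) - g x) < e"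
    by (rule integrable_ccontinuous_explicit[of g]) metis
  \<comment> \<open>The differentiation theorem just used gives right derivatives only; applied to the reflected
    density it gives the left ones.\<close>
  have Gint2: "((\<lambda>x. g (-x)) has_integral G (-s) - G (-t)) {s..t}" if "s \<le> t" for s t
    using has_integral_reflect_lemma_real[OF Gint[of "-t" "-s"]] that by simp
  have "(\<lambda>x. g (-x)) integrable_on cbox a b" for a b
    using Gint2[of a b] by (cases "a \<le> b") (auto simp: integrable_on_def)
  then obtain N2 where N2: "negligible N2"
    and der2: "\<And>x e. \<lbrakk>x \<notin> N2; 0 < e\<rbrakk> \<Longrightarrow> \<exists>d>0. \<forall>h. 0 < h \<and> h < d \<longrightarrow>
      norm (integral (cbox x (x + h *\<^sub>R One)) (\<lambda>x. g (-x)) /\<^sub>R h ^ DIM(real) - g (-x)) < e"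
    by (rule integrable_ccontinuous_explicit[of "\<lambda>x. g (-x)"]) metis
  show thesis
  proof (rule that)
    show "(\<lambda>t. g t - (L + 1)) \<in> borel_measurable borel" by measurable
    have "negligible (uminus ` N2)"
    proof (rule negligible_locally_Lipschitz_image[OF _ N2])
      fix x show "\<exists>T B. open T \<and> x \<in> T \<and> (\<forall>y\<in>N2 \<inter> T. norm (- y - - x) \<le> B * norm (y - x))"
        by (intro exI[of _ UNIV] exI[of _ 1]) auto
    qed simp
    then show "negligible (N1 \<union> uminus ` N2)"
      using N1 by simp
    fix t assume t: "t \<notin> N1 \<union> uminus ` N2"
    then have t2: "- t \<notin> N2" by force
    have "(G has_real_derivative g t) (at t)"
      unfolding DERIV_def LIM_eq
    proof (intro allI impI)
      fix e :: real assume "e > 0"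
      obtain d1 where "d1 > 0" and d1: "\<And>h. 0 < h \<Longrightarrow> h < d1 \<Longrightarrow> \<bar>(G (t + h) - G t) / h - g t\<bar> < e"
      proof -
        obtain d where "d > 0" and d: "\<forall>h. 0 < h \<and> h < d \<longrightarrow>
            norm (integral (cbox t (t + h *\<^sub>R One)) g /\<^sub>R h ^ DIM(real) - g t) < e"
          using der1[of t e] t \<open>e > 0\<close> by auto
        have "\<bar>(G (t + h) - G t) / h - g t\<bar> < e" if "0 < h" "h < d" for h
          using d[rule_format, of h] Gint[of t "t + h"] that
          by (simp add: integral_unique divide_inverse mult.commute)
        then show ?thesis using that \<open>d > 0\<close> by blast
      qed
      obtain d2 where "d2 > 0" and d2: "\<And>h. 0 < h \<Longrightarrow> h < d2 \<Longrightarrow> \<bar>(G t - G (t - h)) / h - g t\<bar> < e"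
      proof -
        obtain d where "d > 0" and d: "\<forall>h. 0 < h \<and> h < d \<longrightarrow>
            norm (integral (cbox (-t) (-t + h *\<^sub>R One)) (\<lambda>x. g (-x)) /\<^sub>R h ^ DIM(real) - g (-(-t))) < e"
          using der2[of "-t" e] t2 \<open>e > 0\<close> by auto
        have "\<bar>(G t - G (t - h)) / h - g t\<bar> < e" if "0 < h" "h < d" for h
          using d[rule_format, of h] Gint2[of "-t" "-t + h"] that
          by (simp add: integral_unique divide_inverse mult.commute)
        then show ?thesis using that \<open>d > 0\<close> by blast
      qed
      show "\<exists>s>0. \<forall>h. h \<noteq> 0 \<and> norm (h - 0) < s \<longrightarrow> norm ((G (t + h) - G t) / h - g t) < e"
      proof (intro exI[of _ "min d1 d2"] conjI allI impI)
        fix h :: real assume h: "h \<noteq> 0 \<and> norm (h - 0) < min d1 d2"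
        show "norm ((G (t + h) - G t) / h - g t) < e"
        proof (cases "h > 0")
          case True then show ?thesis using d1[of h] h by simp
        next
          case False
          have "(G (t + h) - G t) / h = (G t - G (t + h)) / (- h)"
            by (metis minus_diff_eq minus_divide_divide)
          then show ?thesis using d2[of "-h"] h False by simp
        qed
      qed (use \<open>d1 > 0\<close> \<open>d2 > 0\<close> in auto)
    qed
    then have "((\<lambda>s. G s - (L + 1) * s) has_real_derivative g t - (L + 1)) (at t)"
      by (auto intro!: derivative_eq_intros)
    moreover have "(\<lambda>s. G s - (L + 1) * s) = F" by (auto simp: G_def)
    ultimately show "(F has_real_derivative g t - (L + 1)) (at t)" by simp
  qed
qed

lemma AE_lebesgue_on_iff_negligible:
  assumes "S \<in> sets lebesgue"
  shows "(AE t in lebesgue_on S. P t) \<longleftrightarrow> (\<exists>N. negligible N \<and> (\<forall>t\<in>S - N. P t))"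
proof -
  have "(AE t in lebesgue_on S. P t) \<longleftrightarrow> (AE t in lebesgue. t \<in> S \<longrightarrow> P t)"
    using assms by (subst AE_restrict_space_iff) auto
  also have "\<dots> \<longleftrightarrow> (\<exists>N. negligible N \<and> (\<forall>t\<in>S - N. P t))"
    unfolding eventually_ae_filter negligible_iff_null_sets Bex_def
    by (intro ex_cong1) auto
  finally show ?thesis .
qed

lemma absolutely_continuous_on_interval_subset:
  assumes "absolutely_continuous_on_interval s t f" "s \<le> s'" "t' \<le> t"
  shows "absolutely_continuous_on_interval s' t' f"
  unfolding absolutely_continuous_on_interval_def
proof (intro allI impI)
  fix \<epsilon> :: real assume "\<epsilon> > 0"
  obtain \<delta> where "\<delta> > 0" and \<delta>: "\<forall>n (l :: nat \<Rightarrow> real) r.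
        (\<forall>i<n. s \<le> l i \<and> l i \<le> r i \<and> r i \<le> t) \<longrightarrow>
        disjoint_family_on (\<lambda>i. {l i<..<r i}) {..<n} \<longrightarrow>
        (\<Sum>i<n. r i - l i) < \<delta> \<longrightarrow> (\<Sum>i<n. \<bar>f (r i) - f (l i)\<bar>) < \<epsilon>"
    using assms(1)[unfolded absolutely_continuous_on_interval_def, rule_format, OF \<open>\<epsilon> > 0\<close>]
    by (elim exE conjE)
  show "\<exists>\<delta>>0. \<forall>n (l :: nat \<Rightarrow> real) r.
        (\<forall>i<n. s' \<le> l i \<and> l i \<le> r i \<and> r i \<le> t') \<longrightarrow>
        disjoint_family_on (\<lambda>i. {l i<..<r i}) {..<n} \<longrightarrow>
        (\<Sum>i<n. r i - l i) < \<delta> \<longrightarrow> (\<Sum>i<n. \<bar>f (r i) - f (l i)\<bar>) < \<epsilon>"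
  proof (intro exI[of _ \<delta>] conjI allI impI \<open>\<delta> > 0\<close>)
    fix n :: nat and l r :: "nat \<Rightarrow> real"
    assume lr: "\<forall>i<n. s' \<le> l i \<and> l i \<le> r i \<and> r i \<le> t'"
      and rest: "disjoint_family_on (\<lambda>i. {l i<..<r i}) {..<n}" "(\<Sum>i<n. r i - l i) < \<delta>"
    have "s \<le> l i \<and> l i \<le> r i \<and> r i \<le> t" if "i < n" for i
      using lr that assms(2,3) by force
    then show "(\<Sum>i<n. \<bar>f (r i) - f (l i)\<bar>) < \<epsilon>"
      using \<delta> rest by simp
  qed
qed

lemma lipschitz_on_imp_absolutely_continuous_on_interval:
  fixes f :: "real \<Rightarrow> real"
  assumes f: "L-lipschitz_on {s..t} f"
  shows "absolutely_continuous_on_interval s t f"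
  unfolding absolutely_continuous_on_interval_def
proof (intro allI impI)
  fix \<epsilon> :: real assume "\<epsilon> > 0"
  have "L \<ge> 0" using f lipschitz_on_nonneg by blast
  show "\<exists>\<delta>>0. \<forall>n (l :: nat \<Rightarrow> real) r.
        (\<forall>i<n. s \<le> l i \<and> l i \<le> r i \<and> r i \<le> t) \<longrightarrow>
        disjoint_family_on (\<lambda>i. {l i<..<r i}) {..<n} \<longrightarrow>
        (\<Sum>i<n. r i - l i) < \<delta> \<longrightarrow> (\<Sum>i<n. \<bar>f (r i) - f (l i)\<bar>) < \<epsilon>"
  proof (intro exI[of _ "\<epsilon> / (L + 1)"] conjI allI impI)
    show "\<epsilon> / (L + 1) > 0" using \<open>\<epsilon> > 0\<close> \<open>L \<ge> 0\<close> by simp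
    fix n :: nat and l r :: "nat \<Rightarrow> real"
    assume lr: "\<forall>i<n. s \<le> l i \<and> l i \<le> r i \<and> r i \<le> t"
      and sm: "(\<Sum>i<n. r i - l i) < \<epsilon> / (L + 1)"
    have "(\<Sum>i<n. \<bar>f (r i) - f (l i)\<bar>) \<le> (\<Sum>i<n. (L + 1) * (r i - l i))"
    proof (rule sum_mono)
      fix i assume "i \<in> {..<n}"
      then have i: "s \<le> l i" "l i \<le> r i" "r i \<le> t" using lr by auto
      then have "\<bar>f (r i) - f (l i)\<bar> \<le> L * (r i - l i)"
        using lipschitz_onD[OF f, of "r i" "l i"] by (simp add: dist_real_def)
      also have "\<dots> \<le> (L + 1) * (r i - l i)"
        using i by (intro mult_right_mono) auto
      finally show "\<bar>f (r i) - f (l i)\<bar> \<le> (L + 1) * (r i - l i)" .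
    qed
    also have "\<dots> = (L + 1) * (\<Sum>i<n. r i - l i)" by (simp add: sum_distrib_left)
    also have "\<dots> < \<epsilon>" using sm \<open>L \<ge> 0\<close> by (simp add: field_simps)
    finally show "(\<Sum>i<n. \<bar>f (r i) - f (l i)\<bar>) < \<epsilon>" .
  qed
qed

lemma lipschitz_on_has_real_derivative_bound:
  fixes f :: "real \<Rightarrow> real"
  assumes f: "L-lipschitz_on UNIV f" and D: "(f has_real_derivative D) (at x)"
  shows "\<bar>D\<bar> \<le> L"
proof -
  have "((\<lambda>h. (f (x + h) - f x) / h) \<longlongrightarrow> D) (at 0)"
    using D by (simp add: DERIV_def)
  moreover have "\<bar>(f (x + h) - f x) / h\<bar> \<le> L" if "h \<noteq> 0" for h
    using lipschitz_onD[OF f, of "x + h" x] that by (simp add: dist_real_def divide_simps)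
  then have "\<forall>\<^sub>F h in at 0. norm ((f (x + h) - f x) / h) \<le> L"
    by (auto simp: eventually_at intro!: exI[of _ 1])
  ultimately have "norm D \<le> L"
    by (intro Lim_norm_ubound[of "at 0"]) auto
  then show ?thesis by simp
qed

section \<open>Eliminating the control\<close>

lemma rcong_2pi_iff_cos: "[x = y] (rmod (2 * pi)) \<longleftrightarrow> cos (x - y) = 1"
proof
  assume "[x = y] (rmod (2 * pi))"
  then obtain n where "y = x + of_int n * (2 * pi)" by (auto simp: rcong_altdef)
  then have "x - y = of_int (-n) * 2 * pi" by simp
  then show "cos (x - y) = 1" unfolding cos_one_2pi_int by blast
next
  assume "cos (x - y) = 1"
  then obtain n where "x - y = of_int n * 2 * pi" by (auto simp: cos_one_2pi_int)
  then have "y = x + of_int (-n) * (2 * pi)" by (simp add: algebra_simps)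
  then show "[x = y] (rmod (2 * pi))" unfolding rcong_altdef by blast
qed

text \<open>
  The problem with states and control eliminated. The congruence of angles is written with a
  cosine because that is a closed condition, hence stable under pointwise limits.
\<close>

definition heading :: "endpoint \<Rightarrow> endpoint \<Rightarrow> real \<Rightarrow> real \<Rightarrow> (real \<Rightarrow> real) \<Rightarrow> bool" where
  "heading p0 pf T a \<theta> \<longleftrightarrow>
     (case (p0, pf) of ((x0, y0, \<theta>0), (xf, yf, \<theta>f)) \<Rightarrow>
        a-lipschitz_on {0..T} \<theta> \<and>
        cos (\<theta> 0 - \<theta>0) = 1 \<and> cos (\<theta> T - \<theta>f) = 1 \<and>
        ((\<lambda>t. cos (\<theta> t)) has_integral xf - x0) {0..T} \<and>
        ((\<lambda>t. sin (\<theta> t)) has_integral yf - y0) {0..T})"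

lemma admissible_imp_heading:
  assumes adm: "admissible p0 pf T a x y \<theta> u" and "0 \<le> T" "0 \<le> a"
  shows "heading p0 pf T a \<theta>"
proof -
  have ac: "absolutely_continuous_on_interval 0 T x" "absolutely_continuous_on_interval 0 T y"
      "absolutely_continuous_on_interval 0 T \<theta>"
    and ends: "at_endpoint p0 (x 0) (y 0) (\<theta> 0)" "at_endpoint pf (x T) (y T) (\<theta> T)"
    using adm by (simp_all add: admissible_def)
  have "\<exists>N. negligible N \<and> (\<forall>t\<in>{0..T} - N. (x has_real_derivative cos (\<theta> t)) (at t within {0..T}))"
    "\<exists>N. negligible N \<and> (\<forall>t\<in>{0..T} - N. (y has_real_derivative sin (\<theta> t)) (at t within {0..T}))"
    "\<exists>N. negligible N \<and> (\<forall>t\<in>{0..T} - N. (\<theta> has_real_derivative u t) (at t within {0..T}))"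
    "\<exists>N. negligible N \<and> (\<forall>t\<in>{0..T} - N. \<bar>u t\<bar> \<le> a)"
    using adm by (simp_all add: admissible_def flip: AE_lebesgue_on_iff_negligible)
  then obtain N1 N2 N3 N4 where N: "negligible N1" "negligible N2" "negligible N3" "negligible N4"
    and x': "\<forall>t\<in>{0..T} - N1. (x has_real_derivative cos (\<theta> t)) (at t within {0..T})"
    and y': "\<forall>t\<in>{0..T} - N2. (y has_real_derivative sin (\<theta> t)) (at t within {0..T})"
    and \<theta>': "\<forall>t\<in>{0..T} - N3. (\<theta> has_real_derivative u t) (at t within {0..T})"
    and u: "\<forall>t\<in>{0..T} - N4. \<bar>u t\<bar> \<le> a"
    by (elim exE conjE)
  have "((\<lambda>t. cos (\<theta> t)) has_integral x T - x 0) {0..T}"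
    using absolutely_continuous_on_interval_has_integral[OF \<open>0 \<le> T\<close> ac(1) N(1)] x' by simp
  moreover have "((\<lambda>t. sin (\<theta> t)) has_integral y T - y 0) {0..T}"
    using absolutely_continuous_on_interval_has_integral[OF \<open>0 \<le> T\<close> ac(2) N(2)] y' by simp
  moreover have "a-lipschitz_on {0..T} \<theta>"
  proof (rule lipschitz_on_leI[OF _ \<open>0 \<le> a\<close>])
    fix s t assume st: "s \<in> {0..T}" "t \<in> {0..T}" "s \<le> t"
    \<comment> \<open>The control is bounded only off a null set, but the bound on the integral is applied to an
      integrand that is bounded everywhere.\<close>
    define v where "v = (\<lambda>t. if t \<in> N3 \<union> N4 then 0 else u t)"
    have "(v has_integral \<theta> t - \<theta> s) {s..t}"
    proof (rule absolutely_continuous_on_interval_has_integral[OF \<open>s \<le> t\<close>])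
      show "absolutely_continuous_on_interval s t \<theta>"
        using absolutely_continuous_on_interval_subset[OF ac(3)] st by simp
      show "negligible (N3 \<union> N4)" using N by simp
      fix r assume r: "r \<in> {s..t} - (N3 \<union> N4)"
      then have "(\<theta> has_real_derivative v r) (at r within {0..T})"
        using \<theta>' st by (simp add: v_def)
      then show "(\<theta> has_real_derivative v r) (at r within {s..t})"
        by (rule DERIV_subset) (use st in auto)
    qed
    moreover have "norm (v r) \<le> a" if "r \<in> {s..t}" for r
      using u that st \<open>0 \<le> a\<close> by (simp add: v_def)
    ultimately have "norm (\<theta> t - \<theta> s) \<le> a * measure lborel {s..t}"
      by (intro has_integral_bound_real[OF \<open>0 \<le> a\<close> finite.emptyI]) auto
    then show "dist (\<theta> s) (\<theta> t) \<le> a * dist s t"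
      using \<open>s \<le> t\<close> by (simp add: dist_real_def abs_minus_commute)
  qed
  ultimately show ?thesis
    using ends by (cases p0; cases pf) (simp add: heading_def at_endpoint_def rcong_2pi_iff_cos)
qed

lemma feasible_imp_heading:
  assumes "feasible p0 pf T a u" "0 \<le> a"
  obtains \<theta> where "0 \<le> T" "heading p0 pf T a \<theta>"
  using assms admissible_imp_heading unfolding feasible_def by blast

lemma has_integral_antiderivative:
  fixes c :: "real \<Rightarrow> real"
  assumes c: "continuous_on {0..T} c" and bound: "\<And>t. \<bar>c t\<bar> \<le> 1"
    and int: "(c has_integral q - p) {0..T}" and "0 \<le> T"
  obtains x where "absolutely_continuous_on_interval 0 T x" "x 0 = p" "x T = q"
    "\<And>t. t \<in> {0..T} \<Longrightarrow> (x has_real_derivative c t) (at t within {0..T})"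
proof (rule that)
  let ?x = "\<lambda>t. p + integral {0..t} c"
  have der: "(?x has_real_derivative c t) (at t within {0..T})" if "t \<in> {0..T}" for t
    using integral_has_real_derivative[OF c that] by (auto intro!: derivative_eq_intros)
  then show "\<And>t. t \<in> {0..T} \<Longrightarrow> (?x has_real_derivative c t) (at t within {0..T})" .
  have "1-lipschitz_on {0..T} ?x"
  proof (rule bounded_derivative_imp_lipschitz)
    show "\<And>t. t \<in> {0..T} \<Longrightarrow> (?x has_derivative (*) (c t)) (at t within {0..T})"
      using der by (simp add: has_field_derivative_def)
    show "onorm ((*) (c t)) \<le> 1" for t
      using bound[of t] by (intro onorm_le) (simp add: abs_mult mult_left_le_one_le)
  qed auto
  then show "absolutely_continuous_on_interval 0 T ?x"
    by (rule lipschitz_on_imp_absolutely_continuous_on_interval)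
  show "?x 0 = p" by simp
  show "?x T = q" using int by (simp add: integral_unique)
qed

lemma heading_imp_feasible:
  assumes hd: "heading p0 pf T a \<theta>" and "0 \<le> T"
  shows "\<exists>u. feasible p0 pf T a u"
proof -
  obtain x0 y0 \<theta>0 where p0: "p0 = (x0, y0, \<theta>0)" by (cases p0)
  obtain xf yf \<theta>f where pf: "pf = (xf, yf, \<theta>f)" by (cases pf)
  have lip: "a-lipschitz_on {0..T} \<theta>"
    and ends: "cos (\<theta> 0 - \<theta>0) = 1" "cos (\<theta> T - \<theta>f) = 1"
    and int: "((\<lambda>t. cos (\<theta> t)) has_integral xf - x0) {0..T}"
        "((\<lambda>t. sin (\<theta> t)) has_integral yf - y0) {0..T}"
    using hd by (simp_all add: heading_def p0 pf)
  have "a \<ge> 0" using lip lipschitz_on_nonneg by blast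
  have cont: "continuous_on {0..T} \<theta>" using lip by (rule lipschitz_on_continuous_on)
  obtain x where x: "absolutely_continuous_on_interval 0 T x" "x 0 = x0" "x T = xf"
    "\<And>t. t \<in> {0..T} \<Longrightarrow> (x has_real_derivative cos (\<theta> t)) (at t within {0..T})"
    by (rule has_integral_antiderivative[OF _ _ int(1) \<open>0 \<le> T\<close>])
       (auto intro: continuous_intros cont)
  obtain y where y: "absolutely_continuous_on_interval 0 T y" "y 0 = y0" "y T = yf"
    "\<And>t. t \<in> {0..T} \<Longrightarrow> (y has_real_derivative sin (\<theta> t)) (at t within {0..T})"
    by (rule has_integral_antiderivative[OF _ _ int(2) \<open>0 \<le> T\<close>])
       (auto intro: continuous_intros cont)
  \<comment> \<open>Freezing the angle outside the time interval extends it to a Lipschitz function on the line.\<close>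
  define F where "F = (\<lambda>t. \<theta> (max 0 (min T t)))"
  have F: "a-lipschitz_on UNIV F"
  proof (rule lipschitz_onI[OF _ \<open>a \<ge> 0\<close>])
    fix s t :: real
    have "dist (F s) (F t) \<le> a * dist (max 0 (min T s)) (max 0 (min T t))"
      unfolding F_def using \<open>0 \<le> T\<close> by (intro lipschitz_onD[OF lip]) auto
    also have "\<dots> \<le> a * dist s t"
      using \<open>a \<ge> 0\<close> by (intro mult_left_mono) (auto simp: dist_real_def)
    finally show "dist (F s) (F t) \<le> a * dist s t" .
  qed
  obtain w N where w: "w \<in> borel_measurable borel" and N: "negligible N"
    and F': "\<And>t. t \<notin> N \<Longrightarrow> (F has_real_derivative w t) (at t)"
    by (rule lipschitz_on_UNIV_has_ae_derivative[OF F]) blast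
  have wa: "\<bar>w t\<bar> \<le> a" if "t \<notin> N" for t
    using lipschitz_on_has_real_derivative_bound[OF F F'[OF that]] .
  have \<theta>': "(\<theta> has_real_derivative w t) (at t within {0..T})" if "t \<in> {0..T} - N" for t
  proof (rule has_field_derivative_transform_within[OF _ zero_less_one])
    show "(F has_real_derivative w t) (at t within {0..T})"
      using F' that by (auto intro: has_field_derivative_at_within)
  qed (use that in \<open>auto simp: F_def\<close>)
  have "AE t in lebesgue_on {0..T}. \<bar>w t\<bar> \<le> a"
    using N wa by (auto simp: AE_lebesgue_on_iff_negligible)
  moreover have "AE t in lebesgue_on {0..T}. (\<theta> has_real_derivative w t) (at t within {0..T})"
    using N \<theta>' by (auto simp: AE_lebesgue_on_iff_negligible)
  moreover have "w \<in> borel_measurable (lebesgue_on {0..T})"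
    using w by (intro measurable_restrict_space1 measurable_completion) simp
  moreover have "AE t in lebesgue_on {0..T}. (x has_real_derivative cos (\<theta> t)) (at t within {0..T})"
    "AE t in lebesgue_on {0..T}. (y has_real_derivative sin (\<theta> t)) (at t within {0..T})"
    using x(4) y(4) by (auto intro!: AE_I2)
  ultimately have "admissible p0 pf T a x y \<theta> w"
    using x y lipschitz_on_imp_absolutely_continuous_on_interval[OF lip] ends
    by (auto simp: admissible_def L_infinity_on_def at_endpoint_def p0 pf rcong_2pi_iff_cos)
  then show ?thesis
    using \<open>0 \<le> T\<close> by (auto simp: feasible_def)
qed

section \<open>Existence of a minimal curvature bound\<close>

lemma heading_add_2pi:
  assumes "heading p0 pf T a \<theta>"
  shows "heading p0 pf T a (\<lambda>t. \<theta> t + of_int k * 2 * pi)"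
proof -
  obtain x0 y0 \<theta>0 where p0: "p0 = (x0, y0, \<theta>0)" by (cases p0)
  obtain xf yf \<theta>f where pf: "pf = (xf, yf, \<theta>f)" by (cases pf)
  have *: "cos (x + of_int k * 2 * pi) = cos x" "sin (x + of_int k * 2 * pi) = sin x" for x
    using cos_int_2pin[of k] sin_int_2pin[of k] by (simp_all add: cos_add sin_add mult_ac)
  have "cos (x + of_int k * 2 * pi - c) = cos (x - c)" for x c
    using *(1)[of "x - c"] by (simp add: algebra_simps)
  moreover have "a-lipschitz_on {0..T} (\<lambda>t. \<theta> t + of_int k * 2 * pi) \<longleftrightarrow> a-lipschitz_on {0..T} \<theta>"
    by (simp add: lipschitz_on_def dist_real_def)
  ultimately show ?thesis
    using assms * by (simp add: heading_def p0 pf)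
qed

text \<open>
  Pointwise convergence is enough: the cosines and sines are bounded by \<open>1\<close>, so their
  integrals converge by dominated convergence.
\<close>

lemma heading_limit:
  assumes hd: "\<And>n. heading p0 pf T (b n) (\<theta> n)" and b: "b \<longlonglongrightarrow> a"
    and lim: "\<And>t. t \<in> {0..T} \<Longrightarrow> (\<lambda>n. \<theta> n t) \<longlonglongrightarrow> g t" and "0 \<le> T"
  shows "heading p0 pf T a g"
proof -
  obtain x0 y0 \<theta>0 where p0: "p0 = (x0, y0, \<theta>0)" by (cases p0)
  obtain xf yf \<theta>f where pf: "pf = (xf, yf, \<theta>f)" by (cases pf)
  have lip: "(b n)-lipschitz_on {0..T} (\<theta> n)"
    and ends: "cos (\<theta> n 0 - \<theta>0) = 1" "cos (\<theta> n T - \<theta>f) = 1"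
    and int: "((\<lambda>t. cos (\<theta> n t)) has_integral xf - x0) {0..T}"
        "((\<lambda>t. sin (\<theta> n t)) has_integral yf - y0) {0..T}" for n
    using hd[of n] by (simp_all add: heading_def p0 pf)
  have "b n \<ge> 0" for n using lip lipschitz_on_nonneg by blast
  then have "a \<ge> 0" using b LIMSEQ_le_const by blast
  have "a-lipschitz_on {0..T} g"
  proof (rule lipschitz_onI[OF _ \<open>a \<ge> 0\<close>])
    fix s t assume st: "s \<in> {0..T}" "t \<in> {0..T}"
    have "(\<lambda>n. dist (\<theta> n s) (\<theta> n t)) \<longlonglongrightarrow> dist (g s) (g t)"
      by (intro tendsto_intros lim st)
    moreover have "(\<lambda>n. b n * dist s t) \<longlonglongrightarrow> a * dist s t"
      by (intro tendsto_intros b)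
    ultimately show "dist (g s) (g t) \<le> a * dist s t"
      by (rule LIMSEQ_le) (use lipschitz_onD[OF lip st] in auto)
  qed
  moreover have "cos (g r - c) = 1"
    if r: "r \<in> {0..T}" and 1: "\<And>n. cos (\<theta> n r - c) = 1" for r c
  proof -
    have "(\<lambda>n. cos (\<theta> n r - c)) \<longlonglongrightarrow> cos (g r - c)"
      by (intro tendsto_intros lim r)
    then show ?thesis using 1 by (simp add: LIMSEQ_const_iff)
  qed
  then have "cos (g 0 - \<theta>0) = 1" "cos (g T - \<theta>f) = 1"
    using ends \<open>0 \<le> T\<close> by simp_all
  moreover have lim_int: "((\<lambda>t. c (g t)) has_integral i) {0..T}"
    if c: "continuous_on UNIV c" "\<And>s. \<bar>c s\<bar> \<le> 1" and i: "\<And>n. ((\<lambda>t. c (\<theta> n t)) has_integral i) {0..T}"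
    for c :: "real \<Rightarrow> real" and i
  proof -
    have ptw: "\<And>t. t \<in> {0..T} \<Longrightarrow> (\<lambda>n. c (\<theta> n t)) \<longlonglongrightarrow> c (g t)"
      using c(1) by (intro isCont_tendsto_compose[OF _ lim]) (simp_all add: continuous_on_eq_continuous_at)
    have dom: "(\<lambda>t. c (\<theta> n t)) integrable_on {0..T}" "(\<lambda>t::real. 1::real) integrable_on {0..T}"
      "\<And>t. t \<in> {0..T} \<Longrightarrow> norm (c (\<theta> n t)) \<le> 1" for n
      using i c(2) by (auto simp: integrable_on_def)
    have "(\<lambda>t. c (g t)) integrable_on {0..T}"
      and "(\<lambda>n. integral {0..T} (\<lambda>t. c (\<theta> n t))) \<longlonglongrightarrow> integral {0..T} (\<lambda>t. c (g t))"
      using dominated_convergence[OF dom(1) dom(2) dom(3) ptw] by blast+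
    moreover have "integral {0..T} (\<lambda>t. c (\<theta> n t)) = i" for n
      using i by (rule integral_unique)
    ultimately show ?thesis
      by (simp add: LIMSEQ_const_iff has_integral_integral)
  qed
  then have "((\<lambda>t. cos (g t)) has_integral xf - x0) {0..T}"
     "((\<lambda>t. sin (g t)) has_integral yf - y0) {0..T}"
    using lim_int[of cos, OF _ _ int(1)] lim_int[of sin, OF _ _ int(2)]
    by (simp_all add: continuous_on_cos continuous_on_sin)
  ultimately show ?thesis by (simp add: heading_def p0 pf)
qed

text \<open>
  Endpoint angles are prescribed only modulo \<open>2 * pi\<close>, so the sequence itself may be unbounded.
  Shifting each angle function by a multiple of \<open>2 * pi\<close> makes the initial angles equal, after which
  Arzela--Ascoli applies.
\<close>

lemma heading_subsequence_limit:
  assumes hd: "\<And>n. heading p0 pf T (b n) (\<theta> n)" and b: "b \<longlonglongrightarrow> a" and "0 \<le> T"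
  obtains g where "heading p0 pf T a g"
proof -
  obtain x0 y0 \<theta>0 where p0: "p0 = (x0, y0, \<theta>0)" by (cases p0)
  have "\<exists>\<eta>. heading p0 pf T (b n) \<eta> \<and> \<eta> 0 = \<theta>0" for n
  proof -
    have "cos (\<theta> n 0 - \<theta>0) = 1"
      using hd[of n] by (auto simp: heading_def p0 split: prod.splits)
    then obtain k where "\<theta> n 0 - \<theta>0 = of_int k * 2 * pi" by (auto simp: cos_one_2pi_int)
    then show ?thesis
      using heading_add_2pi[OF hd[of n], of "-k"]
      by (intro exI[of _ "\<lambda>t. \<theta> n t + of_int (-k) * 2 * pi"]) simp
  qed
  then obtain \<eta> where \<eta>: "\<And>n. heading p0 pf T (b n) (\<eta> n)" and \<eta>0: "\<And>n. \<eta> n 0 = \<theta>0"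
    by metis
  obtain B where B: "\<And>n. \<bar>b n\<bar> \<le> B"
    using convergent_imp_Bseq[of b] b by (auto simp: convergent_def Bseq_def)
  have lip: "B-lipschitz_on {0..T} (\<eta> n)" for n
  proof -
    have "(b n)-lipschitz_on {0..T} (\<eta> n)"
      using \<eta>[of n] by (auto simp: heading_def split: prod.splits)
    then show ?thesis by (rule lipschitz_on_le) (use B[of n] in simp)
  qed
  have "B \<ge> 0" using lip lipschitz_on_nonneg by blast
  obtain g and k :: "nat \<Rightarrow> nat" where k: "strict_mono k"
    and g: "\<And>e. 0 < e \<Longrightarrow> \<exists>N. \<forall>n t. n \<ge> N \<and> t \<in> {0..T} \<longrightarrow> norm (\<eta> (k n) t - g t) < e"
  proof (rule Arzela_Ascoli[of "{0..T}" \<eta> "\<bar>\<theta>0\<bar> + B * T"])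
    show "norm (\<eta> n t) \<le> \<bar>\<theta>0\<bar> + B * T" if "t \<in> {0..T}" for n t
    proof -
      have "\<bar>\<eta> n t - \<eta> n 0\<bar> \<le> B * t"
        using lipschitz_onD[OF lip, of t 0 n] that by (simp add: dist_real_def)
      also have "\<dots> \<le> B * T" using that \<open>B \<ge> 0\<close> by (intro mult_left_mono) auto
      finally show ?thesis by (simp add: \<eta>0)
    qed
    show "\<exists>d>0. \<forall>n s. s \<in> {0..T} \<and> norm (t - s) < d \<longrightarrow> norm (\<eta> n t - \<eta> n s) < e"
      if "t \<in> {0..T}" "0 < e" for t e
    proof (intro exI[of _ "e / (B + 1)"] conjI allI impI)
      show "e / (B + 1) > 0" using that \<open>B \<ge> 0\<close> by simp
      fix n s assume s: "s \<in> {0..T} \<and> norm (t - s) < e / (B + 1)"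
      have "norm (\<eta> n t - \<eta> n s) \<le> B * norm (t - s)"
        using lipschitz_onD[OF lip, of t s n] that s by (simp add: dist_real_def)
      also have "\<dots> \<le> (B + 1) * norm (t - s)" by (intro mult_right_mono) auto
      also have "\<dots> < e" using s \<open>B \<ge> 0\<close> by (simp add: field_simps)
      finally show "norm (\<eta> n t - \<eta> n s) < e" .
    qed
  qed (auto intro: that)
  have "heading p0 pf T a g"
  proof (rule heading_limit)
    show "heading p0 pf T ((b \<circ> k) n) (\<eta> (k n))" for n using \<eta> by simp
    show "(b \<circ> k) \<longlonglongrightarrow> a" using LIMSEQ_subseq_LIMSEQ[OF b k] .
    show "(\<lambda>n. \<eta> (k n) t) \<longlonglongrightarrow> g t" if "t \<in> {0..T}" for t
      unfolding LIMSEQ_iff using g that by blast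
  qed fact
  then show thesis by (rule that)
qed

text \<open>
  The direct method: take angle functions whose Lipschitz bounds decrease to the infimum of
  the feasible bounds; a limit has the infimum itself as Lipschitz bound.
\<close>

theorem Pc_solution_exists:
  assumes "feasible p0 pf T a u" "0 \<le> a"
  shows "\<exists>c. Pc_solution p0 pf T c"
proof -
  have "0 \<le> T" using assms by (simp add: feasible_def)
  define A where "A = {c. 0 \<le> c \<and> (\<exists>\<theta>. heading p0 pf T c \<theta>)}"
  have A: "c \<in> A" if "0 \<le> c" "feasible p0 pf T c v" for c v
    using that by (auto simp: A_def elim: feasible_imp_heading)
  have bdd: "bdd_below A" by (rule bdd_belowI[of _ 0]) (simp add: A_def)
  define c where "c = Inf A"
  have "\<exists>\<theta>. heading p0 pf T (c + 1 / real (Suc n)) \<theta>" for n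
  proof -
    have "A \<noteq> {}" using A assms by blast
    moreover have "c < c + 1 / real (Suc n)" by simp
    ultimately obtain d where "d \<in> A" "d < c + 1 / real (Suc n)"
      unfolding c_def using cInf_lessD by blast
    then obtain \<theta> where \<theta>: "heading p0 pf T d \<theta>" by (auto simp: A_def)
    have "heading p0 pf T (c + 1 / real (Suc n)) \<theta>"
      using \<theta> \<open>d < _\<close> unfolding heading_def
      by (auto split: prod.splits intro: lipschitz_on_le)
    then show ?thesis by blast
  qed
  then obtain \<theta> where hd: "\<And>n. heading p0 pf T (c + 1 / real (Suc n)) (\<theta> n)" by metis
  have "(\<lambda>n. c + 1 / real (Suc n)) \<longlonglongrightarrow> c + 0"
    by (intro tendsto_add tendsto_const lim_1_over_n[THEN LIMSEQ_Suc])
  then have lim: "(\<lambda>n. c + 1 / real (Suc n)) \<longlonglongrightarrow> c"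
    by (simp only: add_0_right)
  obtain g where g: "heading p0 pf T c g"
    by (rule heading_subsequence_limit[OF hd lim \<open>0 \<le> T\<close>])
  then obtain v where v: "feasible p0 pf T c v"
    using heading_imp_feasible \<open>0 \<le> T\<close> by blast
  have "c \<ge> 0"
    using g lipschitz_on_nonneg by (auto simp: heading_def split: prod.splits)
  have "c \<le> d" if "0 \<le> d" "feasible p0 pf T d w" for d w
    unfolding c_def by (rule cInf_lower[OF A[OF that] bdd])
  then have "Pc_optimal p0 pf T c v"
    using v \<open>c \<ge> 0\<close> by (force simp: Pc_optimal_def is_arg_min_def)
  then show ?thesis by (auto simp: Pc_solution_def)
qed

section \<open>The counterexample\<close>

text \<open>
  The unit segment followed by a full circle of curvature \<open>2 * pi\<close>, which has length \<open>1\<close> and adds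
  no displacement. The final angle \<open>2 * pi\<close> agrees with \<open>0\<close> modulo \<open>2 * pi\<close>.
\<close>

lemma heading_loop: "heading (0, 0, 0) (1, 0, 0) 2 (2 * pi) (\<lambda>t. max 0 (2 * pi * (t - 1)))"
proof -
  let ?\<theta> = "\<lambda>t::real. max 0 (2 * pi * (t - 1))"
  have lip: "(2 * pi)-lipschitz_on {0..2} ?\<theta>"
  proof (rule lipschitz_onI)
    fix s t :: real
    have "\<bar>max 0 (2 * pi * (s - 1)) - max 0 (2 * pi * (t - 1))\<bar> \<le> \<bar>2 * pi * (s - 1) - 2 * pi * (t - 1)\<bar>"
      by linarith
    also have "\<dots> = 2 * pi * \<bar>s - t\<bar>"
      by (simp add: abs_mult flip: right_diff_distrib)
    finally show "dist (?\<theta> s) (?\<theta> t) \<le> 2 * pi * dist s t"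
      by (simp add: dist_real_def)
  qed simp
  \<comment> \<open>Cosine and sine together: the first summand is the segment, the second the circle.\<close>
  have int: "((\<lambda>t. c (?\<theta> t)) has_integral c 0 + (C (2 * pi) - C 0) / (2 * pi)) {0..2}"
    if C: "\<And>x. (C has_real_derivative c x) (at x)" for c C :: "real \<Rightarrow> real"
  proof (rule has_integral_combine[where c = 1])
    have "((\<lambda>t. c 0) has_integral c 0) {0..1::real}"
      using has_integral_const_real[of "c 0" 0 1] by simp
    then show "((\<lambda>t. c (?\<theta> t)) has_integral c 0) {0..1}"
      by (rule has_integral_eq[rotated]) (simp add: max_absorb1 mult_nonneg_nonpos)
    have "((\<lambda>t. c (2 * pi * (t - 1))) has_integral
        C (2 * pi * (2 - 1)) / (2 * pi) - C (2 * pi * (1 - 1)) / (2 * pi)) {1..2}"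
    proof (rule fundamental_theorem_of_calculus)
      fix t :: real
      have "((\<lambda>t. C (2 * pi * (t - 1)) / (2 * pi)) has_real_derivative c (2 * pi * (t - 1))) (at t)"
      proof -
        have "((\<lambda>t. 2 * pi * (t - 1)) has_real_derivative 2 * pi) (at t)"
          by (auto intro!: derivative_eq_intros)
        from DERIV_cdivide[OF DERIV_chain2[OF C this], of "2 * pi"] show ?thesis by simp
      qed
      then show "((\<lambda>t. C (2 * pi * (t - 1)) / (2 * pi)) has_vector_derivative c (2 * pi * (t - 1)))
          (at t within {1..2})"
        by (simp add: has_real_derivative_iff_has_vector_derivative has_vector_derivative_at_within)
    qed simp
    then have "((\<lambda>t. c (2 * pi * (t - 1))) has_integral (C (2 * pi) - C 0) / (2 * pi)) {1..2}"
      by (simp add: diff_divide_distrib)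
    then show "((\<lambda>t. c (?\<theta> t)) has_integral (C (2 * pi) - C 0) / (2 * pi)) {1..2}"
      by (rule has_integral_eq[rotated]) simp
  qed auto
  have "((\<lambda>x. - cos x) has_real_derivative sin x) (at x)" for x :: real
    by (auto intro!: derivative_eq_intros)
  then have "((\<lambda>t. cos (?\<theta> t)) has_integral 1) {0..2}" "((\<lambda>t. sin (?\<theta> t)) has_integral 0) {0..2}"
    using int[of sin cos] int[of "\<lambda>x. - cos x" sin] by (simp_all add: DERIV_sin)
  with lip show ?thesis by (simp add: heading_def)
qed

lemma no_zero_curvature_heading: "\<not> heading (0, 0, 0) (1, 0, 0) 2 0 \<theta>"
proof
  assume hd: "heading (0, 0, 0) (1, 0, 0) 2 0 \<theta>"
  then have lip: "0-lipschitz_on {0..2} \<theta>" and "cos (\<theta> 0) = 1"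
    and int: "((\<lambda>t. cos (\<theta> t)) has_integral 1) {0..2}"
    by (simp_all add: heading_def)
  have "cos (\<theta> t) = 1" if "t \<in> {0..2}" for t
  proof -
    have "\<theta> t = \<theta> 0" using lipschitz_onD[OF lip that, of 0] by simp
    then show ?thesis using \<open>cos (\<theta> 0) = 1\<close> by simp
  qed
  then have "((\<lambda>t. 1) has_integral (1::real)) {0..2::real}"
    by (rule has_integral_eq[OF _ int])
  moreover have "((\<lambda>t. 1) has_integral (2::real)) {0..2::real}"
    using has_integral_const_real[of "1::real" 0 2] by simp
  ultimately show False using has_integral_unique[of "\<lambda>t. 1" 1 "{0..2::real}" "2::real"] by simp
qed

lemma feasible_displacement_le:
  assumes "feasible (x0, y0, \<theta>0) (xf, yf, \<theta>f) T a u" "0 \<le> a"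
  shows "xf - x0 \<le> T"
proof -
  obtain \<theta> where "0 \<le> T" "heading (x0, y0, \<theta>0) (xf, yf, \<theta>f) T a \<theta>"
    by (rule feasible_imp_heading[OF assms])
  then have "((\<lambda>t. cos (\<theta> t)) has_integral xf - x0) {0..T}"
    by (simp add: heading_def)
  moreover have "((\<lambda>t. 1) has_integral T) {0..T}"
    using has_integral_const_real[of "1::real" 0 T] \<open>0 \<le> T\<close> by simp
  ultimately show ?thesis
    by (rule has_integral_le) simp
qed

lemma admissible_segment:
  assumes "0 \<le> a"
  shows "admissible (0, 0, 0) (1, 0, 0) 1 a (\<lambda>t. t) (\<lambda>t. 0) (\<lambda>t. 0) (\<lambda>t. 0)"
proof -
  have "1-lipschitz_on {0..1} (\<lambda>t::real. t)" "0-lipschitz_on {0..1} (\<lambda>t::real. 0::real)"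
    by (auto simp: lipschitz_on_def)
  then have "absolutely_continuous_on_interval 0 1 (\<lambda>t. t)" "absolutely_continuous_on_interval 0 1 (\<lambda>t. 0)"
    by (auto intro: lipschitz_on_imp_absolutely_continuous_on_interval)
  then show ?thesis
    using assms by (auto simp: admissible_def L_infinity_on_def at_endpoint_def intro!: exI[of _ 0])
qed

theorem mainTheorem3:
  shows "\<not> (\<forall>p0 pf tf a. Pc_solution p0 pf tf a \<longrightarrow> MD_solution p0 pf a tf) \<and>
    (\<exists>a. Pc_solution (0, 0, 0) (1, 0, 0) 2 a \<and> a > 0 \<and>
         MD_solution (0, 0, 0) (1, 0, 0) a 1 \<and>
         \<not> MD_solution (0, 0, 0) (1, 0, 0) a 2 \<and>
         (\<exists>x y \<theta> u. admissible (0, 0, 0) (1, 0, 0) 1 a x y \<theta> u \<and>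
            MD_optimal (0, 0, 0) (1, 0, 0) a 1 u \<and>
            (\<forall>t\<in>{0..1}. \<theta> t = 0)))"
proof -
  obtain u where "feasible (0, 0, 0) (1, 0, 0) 2 (2 * pi) u"
    using heading_imp_feasible[OF heading_loop] by auto
  then obtain a where sol: "Pc_solution (0, 0, 0) (1, 0, 0) 2 a"
    using Pc_solution_exists by fastforce
  then obtain v where "0 \<le> a" and v: "feasible (0, 0, 0) (1, 0, 0) 2 a v"
    by (auto simp: Pc_solution_def Pc_optimal_def is_arg_min_def)
  have "a \<noteq> 0"
    using v no_zero_curvature_heading by (auto elim: feasible_imp_heading)
  with \<open>0 \<le> a\<close> have "a > 0" by simp
  note adm = admissible_segment[OF \<open>0 \<le> a\<close>]
  then have feas: "feasible (0, 0, 0) (1, 0, 0) 1 a (\<lambda>t. 0)"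
    by (auto simp: feasible_def)
  have "1 \<le> T" if "feasible (0, 0, 0) (1, 0, 0) T a w" for T w
    using feasible_displacement_le[OF that \<open>0 \<le> a\<close>] by simp
  then have opt: "MD_optimal (0, 0, 0) (1, 0, 0) a 1 (\<lambda>t. 0)"
    using feas by (force simp: MD_optimal_def is_arg_min_def)
  have not2: "\<not> MD_solution (0, 0, 0) (1, 0, 0) a 2"
    using feas by (force simp: MD_solution_def MD_optimal_def is_arg_min_def)
  show ?thesis
    using sol not2 \<open>a > 0\<close> adm opt unfolding MD_solution_def by blast
qed

end
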